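(* Let $\mathcal{S}=(V,\Sigma,\delta)$ be a finite nondeterministic fuzzy transition system, $u,v\in V$ and $k\in\mathbb{N}$. Then the degree-computation algorithm described in the context correctly computes the degree of $k$-limited similarity between $u$ and $v$; that is, its returned value $\mathbf{BIS}((u,v),k)$ is the greatest $\alpha\in[0,1]$ such that $u\approx_k^\alpha v$.
   Context: Let $\otimes$ be a fixed left-continuous $t$-norm on $[0,1]$: commutative, associative, increasing, with neutral element $1$, and $r\otimes\bigvee_i r_i=\bigvee_i (r\otimes r_i)$. Its residuum is $t\rightarrow r=\bigvee\{s\in[0,1]: s\otimes t\le r\}$. $\wedge,\vee$ (and $\bigwedge,\bigvee$) are min, max (inf, sup) in $[0,1]$; $\mathbb{N}$ contains $0$. $V$ is a nonempty finite set; $\mathcal{R}(V)$ is the set of fuzzy subsets of $V$ (maps $V\to[0,1]$), also called distributions. For $p\in\mathcal{R}(V)$ and $X\subseteq V$, $p(X)=\bigvee_{x\in X}p(x)$ (with $p(\emptyset)=0$). A nondeterministic fuzzy transition system (NFTS) is a triple $\mathcal{S}=(V,\Sigma,\delta)$ with $\Sigma$ a set of labels and $\delta\subseteq V\times\Sigma\times\mathcal{R}(V)$; $\delta(u,\tau)=\{p:(u,\tau,p)\in\delta\}$, and $u\overset{\tau}{\longrightarrow}p$ means $p\in\delta(u,\tau)$. It is finite if $V$ and $\Sigma$ are finite and every $\delta(u,\tau)$ is finite. For $R\subseteq V\times V$: $\overrightarrow{R}_u=\{v:(u,v)\in R\}$, $\overleftarrow{R}_u=\{v:(v,u)\in R\}$,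 and $\widetilde{S}(p,q,R)=\bigwedge_{u\in V}\big((p(u)\rightarrow q(\overrightarrow{R}_u))\wedge(q(u)\rightarrow p(\overleftarrow{R}_u))\big)$. The lifted relation is $R_\alpha^{\dagger}=\{(p,q)\in\mathcal{R}(V)\times\mathcal{R}(V):\widetilde{S}(p,q,R)\ge\alpha\}$. $k$-limited $\alpha$-bisimilarity $\approx_k^{\alpha}\subseteq V\times V$: $u\approx_0^\alpha v$ for all $u,v$; and $u\approx_{i+1}^\alpha v$ iff for each $\tau\in\Sigma$: $u\overset{\tau}{\longrightarrow}p$ implies there is $v\overset{\tau}{\longrightarrow}q$ with $(p,q)\in(\approx_i^\alpha)_\alpha^\dagger$; and $v\overset{\tau}{\longrightarrow}q$ implies there is $u\overset{\tau}{\longrightarrow}p$ with $(p,q)\in(\approx_i^\alpha)_\alpha^\dagger$. The degree of $k$-limited similarity between $u$ and $v$ is the greatest $\alpha$ such that $u\approx_k^\alpha v$. $D_u[0]=\{u\}$ and $D_u[i+1]=\{y\in V:\exists x\in D_u[i],\tau\in\Sigma,p\in\delta(x,\tau)\text{ with }p(y)>0\}$. Algorithm. For $x,y\in V$ and $R\subseteq V\times V$ let $\mathbf{Deg}((x,y),R)=\bigwedge_{x\overset{\tau}{\to}p}\bigvee_{y\overset{\tau}{\to}q}\widetilde{S}(p,q,R)\wedge\bigwedge_{y\overset{\tau}{\to}q}\bigvee_{x\overset{\tau}{\to}p}\widetilde{S}(p,q,R)$ (the outer infima range over all labels $\tau$ and all transitions from the state). For a $(k+1)$-vector $C$ of relations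 on $V$ and $\alpha\in[0,1]$, $\mathbf{Vec}((u,v),k,\alpha,C)$ is the $(k+1)$-vector $A$ computed by $A[k+1]=C[k+1]$ and, for $i=k,k-1,\ldots,1$, $A[i]=\{r\in C[i]:\mathbf{Deg}(r,A[i+1])\ge\alpha\}$. Degree computation: put $B(u,v)[i+1]=D_u[i]\times D_v[i]$ ($0\le i\le k$), $\alpha_0=\epsilon=0$, $T_1=\mathbf{Vec}((u,v),k,\epsilon,B(u,v))$. For $j=1,2,\ldots$: as long as $T_j[1]=\{(u,v)\}$, set $\alpha_j=\bigwedge_{1\le i\le k}\bigwedge_{r\in T_j[i]}\mathbf{Deg}(r,T_j[i+1])$; let $B_{j+1}$ be obtained from $T_j$ by deleting, from each component $T_j[i]$ with $1\le i\le k$, all $r$ with $\mathbf{Deg}(r,T_j[i+1])\le\alpha_j$ (the component $k+1$ is unchanged); and set $T_{j+1}=\mathbf{Vec}((u,v),k,\alpha_j,B_{j+1})$. When $T_j[1]=\emptyset$, stop and return $\mathbf{BIS}((u,v),k)=\alpha_{j-1}$.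
   Formalization: If no α satisfies u ≈_k^α v (e.g. k=1, u has a transition and v none), the degree is taken to be 0; for k=0, where the loop never stops, the returned value is taken to be the supremum of the α_j (which is 1), and termination is claimed only for k ≥ 1. *)

theory Defs
  imports Complex_Main
begin

text \<open>
  The truth values form the real unit interval as a complete chain, so that
  \<^const>\<open>Sup\<close> and \<^const>\<open>Inf\<close> are taken in \<open>[0,1]\<close>: \<open>Sup {} = bot\<close> is the number 0
  and \<open>Inf {} = top\<close> is the number 1.
\<close>

typedef unit_interval = "{0..1::real}"
  morphisms real_of_ui ui_of_real
  by (rule exI[of _ 0]) simp

setup_lifting type_definition_unit_interval

instantiation unit_interval :: complete_linorder
begin

lift_definition less_eq_unit_interval :: "unit_interval \<Rightarrow> unit_interval \<Rightarrow> bool"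
  is "(\<le>)" .

lift_definition less_unit_interval :: "unit_interval \<Rightarrow> unit_interval \<Rightarrow> bool"
  is "(<)" .

lift_definition bot_unit_interval :: unit_interval is 0 by simp

lift_definition top_unit_interval :: unit_interval is 1 by simp

lift_definition inf_unit_interval :: "unit_interval \<Rightarrow> unit_interval \<Rightarrow> unit_interval"
  is min by (auto simp: min_def)

lift_definition sup_unit_interval :: "unit_interval \<Rightarrow> unit_interval \<Rightarrow> unit_interval"
  is max by (auto simp: max_def)

definition Sup_unit_interval :: "unit_interval set \<Rightarrow> unit_interval" where
  "Sup_unit_interval A = ui_of_real (Sup (insert 0 (real_of_ui ` A)))"

definition Inf_unit_interval :: "unit_interval set \<Rightarrow> unit_interval" where
  "Inf_unit_interval A = ui_of_real (Inf (insert 1 (real_of_ui ` A)))"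

instance
proof
  have bounds: "0 \<le> real_of_ui x" "real_of_ui x \<le> 1" for x
    using real_of_ui[of x] by auto
  have bdd: "bdd_above (insert 0 (real_of_ui ` A))" "bdd_below (insert 1 (real_of_ui ` A))" for A
    using bounds by (auto intro!: bdd_aboveI[of _ 1] bdd_belowI[of _ 0])
  have Sup: "real_of_ui (Sup A) = Sup (insert 0 (real_of_ui ` A))" for A
    unfolding Sup_unit_interval_def
  proof (rule ui_of_real_inverse)
    have "0 \<le> Sup (insert 0 (real_of_ui ` A))"
      by (rule cSup_upper) (use bdd in auto)
    moreover have "Sup (insert 0 (real_of_ui ` A)) \<le> 1"
      by (rule cSup_least) (use bounds in auto)
    ultimately show "Sup (insert 0 (real_of_ui ` A)) \<in> {0..1}" by simp
  qed
  have Inf: "real_of_ui (Inf A) = Inf (insert 1 (real_of_ui ` A))" for A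
    unfolding Inf_unit_interval_def
  proof (rule ui_of_real_inverse)
    have "Inf (insert 1 (real_of_ui ` A)) \<le> 1"
      by (rule cInf_lower) (use bdd in auto)
    moreover have "0 \<le> Inf (insert 1 (real_of_ui ` A))"
      by (rule cInf_greatest) (use bounds in auto)
    ultimately show "Inf (insert 1 (real_of_ui ` A)) \<in> {0..1}" by simp
  qed
  fix x y z :: unit_interval and A :: "unit_interval set"
  show "(x < y) = (x \<le> y \<and> \<not> y \<le> x)" by transfer auto
  show "x \<le> x" by transfer simp
  show "x \<le> y \<Longrightarrow> y \<le> z \<Longrightarrow> x \<le> z" by transfer simp
  show "x \<le> y \<Longrightarrow> y \<le> x \<Longrightarrow> x = y" by transfer simp
  show "x \<le> y \<or> y \<le> x" by transfer auto
  show "inf x y \<le> x" "inf x y \<le> y" by (transfer, simp)+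
  show "x \<le> y \<Longrightarrow> x \<le> z \<Longrightarrow> x \<le> inf y z" by transfer simp
  show "x \<le> sup x y" "y \<le> sup x y" by (transfer, simp)+
  show "y \<le> x \<Longrightarrow> z \<le> x \<Longrightarrow> sup y z \<le> x" by transfer simp
  show "Inf A \<le> x" if "x \<in> A"
    unfolding less_eq_unit_interval.rep_eq Inf by (rule cInf_lower) (use that bdd in auto)
  show "z \<le> Inf A" if "\<And>x. x \<in> A \<Longrightarrow> z \<le> x"
    unfolding less_eq_unit_interval.rep_eq Inf
    by (rule cInf_greatest) (use that bounds in \<open>auto simp: less_eq_unit_interval.rep_eq\<close>)
  show "x \<le> Sup A" if "x \<in> A"
    unfolding less_eq_unit_interval.rep_eq Sup by (rule cSup_upper) (use that bdd in auto)
  show "Sup A \<le> z" if "\<And>x. x \<in> A \<Longrightarrow> x \<le> z"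
    unfolding less_eq_unit_interval.rep_eq Sup
    by (rule cSup_least) (use that bounds in \<open>auto simp: less_eq_unit_interval.rep_eq\<close>)
  show "Inf {} = (top :: unit_interval)"
    by (simp add: Inf_unit_interval_def top_unit_interval_def)
  show "Sup {} = (bot :: unit_interval)"
    by (simp add: Sup_unit_interval_def bot_unit_interval_def)
qed

end


locale left_continuous_tnorm =
  fixes tn :: "unit_interval \<Rightarrow> unit_interval \<Rightarrow> unit_interval"
  assumes commute: "tn r s = tn s r"
    and assoc: "tn (tn r s) t = tn r (tn s t)"
    and mono: "r \<le> r' \<Longrightarrow> s \<le> s' \<Longrightarrow> tn r s \<le> tn r' s'"
    and neutral: "tn r top = r"
    and left_continuous: "tn r (Sup A) = (SUP s\<in>A. tn r s)"

definition residuum ::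
  "(unit_interval \<Rightarrow> unit_interval \<Rightarrow> unit_interval) \<Rightarrow> unit_interval \<Rightarrow> unit_interval \<Rightarrow> unit_interval" where
  "residuum tn t r = Sup {s. tn s t \<le> r}"


text \<open>
  The nonempty finite state set is a type \<open>'v\<close> of class \<^class>\<open>finite\<close>; the label set is an
  explicit (possibly empty) set over a type \<open>'l\<close>.
\<close>

type_synonym 'v distribution = "'v \<Rightarrow> unit_interval"
type_synonym ('v, 'l) transitions = "('v \<times> 'l \<times> 'v distribution) set"

definition fuzzy_measure :: "'v distribution \<Rightarrow> 'v set \<Rightarrow> unit_interval" where
  "fuzzy_measure p X = (SUP x\<in>X. p x)"

definition post :: "('v, 'l) transitions \<Rightarrow> 'v \<Rightarrow> 'l \<Rightarrow> 'v distribution set" where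
  "post \<delta> u \<tau> = {p. (u, \<tau>, p) \<in> \<delta>}"

definition nfts :: "'l set \<Rightarrow> ('v::finite, 'l) transitions \<Rightarrow> bool" where
  "nfts \<Sigma> \<delta> \<longleftrightarrow> \<delta> \<subseteq> UNIV \<times> \<Sigma> \<times> UNIV"

definition finite_nfts :: "'l set \<Rightarrow> ('v::finite, 'l) transitions \<Rightarrow> bool" where
  "finite_nfts \<Sigma> \<delta> \<longleftrightarrow> nfts \<Sigma> \<delta> \<and> finite \<Sigma> \<and> (\<forall>u. \<forall>\<tau>\<in>\<Sigma>. finite (post \<delta> u \<tau>))"

definition sim ::
  "(unit_interval \<Rightarrow> unit_interval \<Rightarrow> unit_interval) \<Rightarrow> 'v distribution \<Rightarrow> 'v distribution
    \<Rightarrow> ('v \<times> 'v) set \<Rightarrow> unit_interval" where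
  "sim tn p q R =
    (INF u. inf (residuum tn (p u) (fuzzy_measure q {v. (u, v) \<in> R}))
                (residuum tn (q u) (fuzzy_measure p {v. (v, u) \<in> R})))"

definition lifted ::
  "(unit_interval \<Rightarrow> unit_interval \<Rightarrow> unit_interval) \<Rightarrow> unit_interval \<Rightarrow> ('v \<times> 'v) set
    \<Rightarrow> ('v distribution \<times> 'v distribution) set" where
  "lifted tn \<alpha> R = {(p, q). sim tn p q R \<ge> \<alpha>}"

primrec lim_bisim ::
  "(unit_interval \<Rightarrow> unit_interval \<Rightarrow> unit_interval) \<Rightarrow> 'l set \<Rightarrow> ('v, 'l) transitions
    \<Rightarrow> unit_interval \<Rightarrow> nat \<Rightarrow> ('v \<times> 'v) set" where
  "lim_bisim tn \<Sigma> \<delta> \<alpha> 0 = UNIV"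
| "lim_bisim tn \<Sigma> \<delta> \<alpha> (Suc i) =
    {(u, v). \<forall>\<tau>\<in>\<Sigma>.
      (\<forall>p\<in>post \<delta> u \<tau>. \<exists>q\<in>post \<delta> v \<tau>. (p, q) \<in> lifted tn \<alpha> (lim_bisim tn \<Sigma> \<delta> \<alpha> i)) \<and>
      (\<forall>q\<in>post \<delta> v \<tau>. \<exists>p\<in>post \<delta> u \<tau>. (p, q) \<in> lifted tn \<alpha> (lim_bisim tn \<Sigma> \<delta> \<alpha> i))}"

text \<open>
  The greatest \<open>\<alpha>\<close> with \<open>u \<approx>\<^sub>k\<^sup>\<alpha> v\<close>. If there is no such \<open>\<alpha>\<close> at all (e.g. \<open>k > 0\<close> and only one
  of \<open>u\<close>, \<open>v\<close> has a transition under some label, so that even \<open>\<alpha> = 0\<close> fails), the degree is 0,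
  the join of the empty set in \<open>[0,1]\<close>.
\<close>

definition is_degree ::
  "(unit_interval \<Rightarrow> unit_interval \<Rightarrow> unit_interval) \<Rightarrow> 'l set \<Rightarrow> ('v, 'l) transitions
    \<Rightarrow> 'v \<Rightarrow> 'v \<Rightarrow> nat \<Rightarrow> unit_interval \<Rightarrow> bool" where
  "is_degree tn \<Sigma> \<delta> u v k \<beta> \<longleftrightarrow>
    (if \<exists>\<alpha>. (u, v) \<in> lim_bisim tn \<Sigma> \<delta> \<alpha> k
     then (u, v) \<in> lim_bisim tn \<Sigma> \<delta> \<beta> k \<and> (\<forall>\<alpha>. (u, v) \<in> lim_bisim tn \<Sigma> \<delta> \<alpha> k \<longrightarrow> \<alpha> \<le> \<beta>)
     else \<beta> = bot)"


primrec reach :: "'l set \<Rightarrow> ('v, 'l) transitions \<Rightarrow> 'v \<Rightarrow> nat \<Rightarrow> 'v set" where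
  "reach \<Sigma> \<delta> u 0 = {u}"
| "reach \<Sigma> \<delta> u (Suc i) = {y. \<exists>x\<in>reach \<Sigma> \<delta> u i. \<exists>\<tau>\<in>\<Sigma>. \<exists>p\<in>post \<delta> x \<tau>. p y > bot}"

definition Deg ::
  "(unit_interval \<Rightarrow> unit_interval \<Rightarrow> unit_interval) \<Rightarrow> 'l set \<Rightarrow> ('v, 'l) transitions
    \<Rightarrow> 'v \<times> 'v \<Rightarrow> ('v \<times> 'v) set \<Rightarrow> unit_interval" where
  "Deg tn \<Sigma> \<delta> r R = (case r of (x, y) \<Rightarrow>
    inf (INF \<tau>\<in>\<Sigma>. INF p\<in>post \<delta> x \<tau>. SUP q\<in>post \<delta> y \<tau>. sim tn p q R)
        (INF \<tau>\<in>\<Sigma>. INF q\<in>post \<delta> y \<tau>. SUP p\<in>post \<delta> x \<tau>. sim tn p q R))"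

text \<open>
  A \<open>(k+1)\<close>-vector of relations is a function on \<^typ>\<open>nat\<close> of which only the values at the
  indices \<open>1, \<dots>, k+1\<close> matter.
\<close>

type_synonym 'v relvec = "nat \<Rightarrow> ('v \<times> 'v) set"

function Vec ::
  "(unit_interval \<Rightarrow> unit_interval \<Rightarrow> unit_interval) \<Rightarrow> 'l set \<Rightarrow> ('v, 'l) transitions
    \<Rightarrow> nat \<Rightarrow> unit_interval \<Rightarrow> 'v relvec \<Rightarrow> 'v relvec" where
  "Vec tn \<Sigma> \<delta> k \<alpha> C i =
    (if 1 \<le> i \<and> i \<le> k then {r \<in> C i. Deg tn \<Sigma> \<delta> r (Vec tn \<Sigma> \<delta> k \<alpha> C (i + 1)) \<ge> \<alpha>} else C i)"
  by pat_completeness auto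
termination by (relation "measure (\<lambda>(tn, \<Sigma>, \<delta>, k, \<alpha>, C, i). k + 1 - i)") auto

declare Vec.simps [simp del]

definition init_vec :: "'l set \<Rightarrow> ('v, 'l) transitions \<Rightarrow> 'v \<Rightarrow> 'v \<Rightarrow> 'v relvec" where
  "init_vec \<Sigma> \<delta> u v i = reach \<Sigma> \<delta> u (i - 1) \<times> reach \<Sigma> \<delta> v (i - 1)"

definition min_deg ::
  "(unit_interval \<Rightarrow> unit_interval \<Rightarrow> unit_interval) \<Rightarrow> 'l set \<Rightarrow> ('v, 'l) transitions
    \<Rightarrow> nat \<Rightarrow> 'v relvec \<Rightarrow> unit_interval" where
  "min_deg tn \<Sigma> \<delta> k T = (INF i\<in>{1..k}. INF r\<in>T i. Deg tn \<Sigma> \<delta> r (T (i + 1)))"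

definition delete_vec ::
  "(unit_interval \<Rightarrow> unit_interval \<Rightarrow> unit_interval) \<Rightarrow> 'l set \<Rightarrow> ('v, 'l) transitions
    \<Rightarrow> nat \<Rightarrow> unit_interval \<Rightarrow> 'v relvec \<Rightarrow> 'v relvec" where
  "delete_vec tn \<Sigma> \<delta> k \<alpha> T i =
    (if 1 \<le> i \<and> i \<le> k then T i - {r. Deg tn \<Sigma> \<delta> r (T (i + 1)) \<le> \<alpha>} else T i)"

text \<open>
  \<open>T_seq \<dots> j\<close> is the vector \<open>T\<^bsub>j+1\<^esub>\<close>, and \<open>alpha_seq \<dots> j\<close> is \<open>\<alpha>\<^sub>j\<close>. Both continue formally
  beyond the iteration at which the loop is left; those values are not used.
\<close>

primrec T_seq ::
  "(unit_interval \<Rightarrow> unit_interval \<Rightarrow> unit_interval) \<Rightarrow> 'l set \<Rightarrow> ('v, 'l) transitions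
    \<Rightarrow> 'v \<Rightarrow> 'v \<Rightarrow> nat \<Rightarrow> nat \<Rightarrow> 'v relvec" where
  "T_seq tn \<Sigma> \<delta> u v k 0 = Vec tn \<Sigma> \<delta> k bot (init_vec \<Sigma> \<delta> u v)"
| "T_seq tn \<Sigma> \<delta> u v k (Suc j) =
    (let T = T_seq tn \<Sigma> \<delta> u v k j; \<alpha> = min_deg tn \<Sigma> \<delta> k T
     in Vec tn \<Sigma> \<delta> k \<alpha> (delete_vec tn \<Sigma> \<delta> k \<alpha> T))"

definition alpha_seq ::
  "(unit_interval \<Rightarrow> unit_interval \<Rightarrow> unit_interval) \<Rightarrow> 'l set \<Rightarrow> ('v, 'l) transitions
    \<Rightarrow> 'v \<Rightarrow> 'v \<Rightarrow> nat \<Rightarrow> nat \<Rightarrow> unit_interval" where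
  "alpha_seq tn \<Sigma> \<delta> u v k j =
    (case j of 0 \<Rightarrow> bot | Suc j' \<Rightarrow> min_deg tn \<Sigma> \<delta> k (T_seq tn \<Sigma> \<delta> u v k j'))"

text \<open>
  With \<open>T_seq \<dots> j = T\<^bsub>j+1\<^esub>\<close>, the loop is left at the first \<open>j\<close> with \<open>T_seq \<dots> j 1 = {}\<close> and
  returns \<open>\<alpha>\<^sub>j\<close>.
\<close>

definition terminates ::
  "(unit_interval \<Rightarrow> unit_interval \<Rightarrow> unit_interval) \<Rightarrow> 'l set \<Rightarrow> ('v, 'l) transitions
    \<Rightarrow> 'v \<Rightarrow> 'v \<Rightarrow> nat \<Rightarrow> bool" where
  "terminates tn \<Sigma> \<delta> u v k \<longleftrightarrow> (\<exists>j. T_seq tn \<Sigma> \<delta> u v k j 1 = {})"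

text \<open>
  For \<open>k = 0\<close> the loop has no component to delete from and never stops: \<open>T\<^sub>j\<close> is constant and
  \<open>\<alpha>\<^sub>j = Inf {} = 1\<close> for \<open>j \<ge> 1\<close>. A run that does not stop is assigned the value its thresholds
  converge to, which is their join.
\<close>

definition BIS ::
  "(unit_interval \<Rightarrow> unit_interval \<Rightarrow> unit_interval) \<Rightarrow> 'l set \<Rightarrow> ('v, 'l) transitions
    \<Rightarrow> 'v \<Rightarrow> 'v \<Rightarrow> nat \<Rightarrow> unit_interval" where
  "BIS tn \<Sigma> \<delta> u v k =
    (if terminates tn \<Sigma> \<delta> u v k
     then alpha_seq tn \<Sigma> \<delta> u v k (LEAST j. T_seq tn \<Sigma> \<delta> u v k j 1 = {})
     else (SUP j. alpha_seq tn \<Sigma> \<delta> u v k j))"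

end

theory Submission
  imports Defs
begin

text \<open>
  Call a vector \<open>T\<close> of relations \<open>\<alpha>\<close>-stable if every pair in a component \<open>T i\<close> with
  \<open>1 \<le> i \<le> k\<close> has degree at least \<open>\<alpha>\<close> with respect to the next component. Three facts about
  stability explain the algorithm.

  First, for \<open>\<alpha> > 0\<close> stability is the threshold form of limited bisimilarity. Since the sets of
  transitions are finite, a supremum of similarities reaches a positive \<open>\<alpha>\<close> exactly if one of
  the similarities does; so \<open>Deg r R \<ge> \<alpha>\<close> is the transfer condition of \<open>\<alpha>\<close>-bisimilarity
  (\<open>Deg_ge_iff_matching\<close>). Hence the pairs in component \<open>i\<close> of an \<open>\<alpha>\<close>-stable vector are
  \<open>(k + 1 - i)\<close>-limited \<open>\<alpha>\<close>-bisimilar (\<open>stable_imp_lim_bisim\<close>). Conversely, the relations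
  \<open>\<approx>\<^sub>k\<^sup>\<alpha>, \<dots>, \<approx>\<^sub>0\<^sup>\<alpha>\<close> form an \<open>\<alpha>\<close>-stable vector, and they still do so after restriction to
  the states that can be reached from \<open>u\<close> and \<open>v\<close> in the corresponding number of steps, because
  similarity only looks at states in the supports of the two distributions
  (\<open>stable_reachable_bisim\<close>).

  Second, \<open>Vec\<close> computes the greatest \<open>\<alpha>\<close>-stable subvector of its
  argument, and \<open>min_deg T\<close> is the greatest \<open>\<alpha>\<close> for which
  \<open>T\<close> is \<open>\<alpha>\<close>-stable. So the thresholds
  \<open>\<alpha>\<^sub>j\<close> increase, and one round of the loop, while it deletes every pair
  of minimal degree, loses no pair of a vector that is stable for a threshold above
  \<open>\<alpha>\<^sub>j\<close> (\<open>stable_subvector_survives\<close>).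

  Third, each round deletes at least one pair as long as the first component is nonempty, so for
  \<open>k \<ge> 1\<close> the loop stops (\<open>terminates_if_pos\<close>). Let
  \<open>\<alpha>\<close> be the returned threshold. The last vector with nonempty first component
  contains \<open>(u, v)\<close> there and is \<open>\<alpha>\<close>-stable, so \<open>u\<close>
  and \<open>v\<close> are \<open>\<alpha>\<close>-bisimilar if \<open>\<alpha> > 0\<close>. The
  next vector has an empty first component but would contain the restricted bisimilarity vector of
  any larger threshold, so no larger threshold relates \<open>u\<close> and \<open>v\<close>.

  The threshold 0 is exceptional: \<open>Deg r R \<ge> 0\<close> holds even where a transition has no
  counterpart under the same label, whereas \<open>0\<close>-bisimilarity demands one. If the algorithm
  returns 0, however, no positive threshold relates \<open>u\<close> and \<open>v\<close>, and then the degree is 0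
  whether or not \<open>u\<close> and \<open>v\<close> are \<open>0\<close>-bisimilar.
\<close>

section \<open>Similarity of distributions\<close>

lemma residuum_mono: "r \<le> r' \<Longrightarrow> residuum tn t r \<le> residuum tn t r'"
  unfolding residuum_def by (intro Sup_subset_mono) auto

lemma residuum_bot:
  assumes "left_continuous_tnorm tn"
  shows "residuum tn bot r = top"
proof -
  interpret left_continuous_tnorm tn by fact
  have "tn top bot = bot"
    using commute[of top bot] neutral by simp
  then show ?thesis
    unfolding residuum_def by (intro top_le Sup_upper) simp
qed

lemma fuzzy_measure_mono: "X \<subseteq> Y \<Longrightarrow> fuzzy_measure p X \<le> fuzzy_measure p Y"
  unfolding fuzzy_measure_def by (rule SUP_subset_mono) auto

lemma fuzzy_measure_restrict_support:
  assumes "\<And>x. x \<in> X \<Longrightarrow> x \<notin> A \<Longrightarrow> p x = bot"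
  shows "fuzzy_measure p (X \<inter> A) = fuzzy_measure p X"
proof (rule antisym)
  show "fuzzy_measure p X \<le> fuzzy_measure p (X \<inter> A)"
    unfolding fuzzy_measure_def
  proof (rule SUP_least)
    fix x assume "x \<in> X"
    then show "p x \<le> (SUP x\<in>X \<inter> A. p x)"
      using assms by (cases "x \<in> A") (auto intro: SUP_upper)
  qed
qed (simp add: fuzzy_measure_mono)

lemma sim_mono: "R \<subseteq> R' \<Longrightarrow> sim tn p q R \<le> sim tn p q R'"
  unfolding sim_def
  by (intro INF_mono' inf_mono residuum_mono fuzzy_measure_mono) auto

text \<open>
  A state outside the support of the first distribution contributes an implication with premise 0,
  which has value 1; related states outside the support of the second one do not change the
  measure that forms the conclusion.
\<close>

lemma sim_restrict_supports:
  assumes tn: "left_continuous_tnorm tn"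
    and p: "\<And>x. x \<notin> A \<Longrightarrow> p x = bot" and q: "\<And>y. y \<notin> B \<Longrightarrow> q y = bot"
  shows "sim tn p q (A \<times> B \<inter> R) = sim tn p q R"
proof -
  have "residuum tn (p x) (fuzzy_measure q {y. (x, y) \<in> A \<times> B \<inter> R})
      = residuum tn (p x) (fuzzy_measure q {y. (x, y) \<in> R})" for x
  proof (cases "x \<in> A")
    case True
    then have "{y. (x, y) \<in> A \<times> B \<inter> R} = {y. (x, y) \<in> R} \<inter> B" by auto
    then show ?thesis by (simp add: fuzzy_measure_restrict_support q)
  qed (simp add: p residuum_bot[OF tn])
  moreover have "residuum tn (q y) (fuzzy_measure p {x. (x, y) \<in> A \<times> B \<inter> R})
      = residuum tn (q y) (fuzzy_measure p {x. (x, y) \<in> R})" for y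
  proof (cases "y \<in> B")
    case True
    then have "{x. (x, y) \<in> A \<times> B \<inter> R} = {x. (x, y) \<in> R} \<inter> A" by auto
    then show ?thesis by (simp add: fuzzy_measure_restrict_support p)
  qed (simp add: q residuum_bot[OF tn])
  ultimately show ?thesis unfolding sim_def by simp
qed

section \<open>Degrees and the transfer condition\<close>

lemma Deg_mono: "R \<subseteq> R' \<Longrightarrow> Deg tn \<Sigma> \<delta> r R \<le> Deg tn \<Sigma> \<delta> r R'"
  unfolding Deg_def
  by (cases r) (simp only: prod.case, intro inf_mono INF_mono' SUP_mono' sim_mono)

text \<open>
  For \<open>\<alpha> = bot\<close> this fails if \<open>A\<close> is empty.
\<close>

lemma le_SUP_finite_iff:
  fixes f :: "'a \<Rightarrow> 'b::complete_linorder"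
  assumes "finite A" and "bot < \<alpha>"
  shows "\<alpha> \<le> (SUP x\<in>A. f x) \<longleftrightarrow> (\<exists>x\<in>A. \<alpha> \<le> f x)"
  using assms(1)
proof induction
  case empty
  then show ?case using assms(2) by (simp add: bot_unique)
next
  case (insert x A)
  then show ?case by (simp add: sup_max le_max_iff_disj)
qed

lemma Deg_ge_iff_matching:
  assumes "finite_nfts \<Sigma> \<delta>" and "bot < \<alpha>"
  shows "\<alpha> \<le> Deg tn \<Sigma> \<delta> (x, y) R \<longleftrightarrow> (\<forall>\<tau>\<in>\<Sigma>.
      (\<forall>p\<in>post \<delta> x \<tau>. \<exists>q\<in>post \<delta> y \<tau>. \<alpha> \<le> sim tn p q R) \<and>
      (\<forall>q\<in>post \<delta> y \<tau>. \<exists>p\<in>post \<delta> x \<tau>. \<alpha> \<le> sim tn p q R))"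
proof -
  have "finite (post \<delta> z \<tau>)" if "\<tau> \<in> \<Sigma>" for z \<tau>
    using assms(1) that by (auto simp: finite_nfts_def)
  then show ?thesis
    by (auto simp: Deg_def le_INF_iff le_SUP_finite_iff[OF _ assms(2)])
qed

lemma lim_bisim_Suc_iff_Deg:
  assumes "finite_nfts \<Sigma> \<delta>" and "bot < \<alpha>"
  shows "r \<in> lim_bisim tn \<Sigma> \<delta> \<alpha> (Suc i) \<longleftrightarrow> \<alpha> \<le> Deg tn \<Sigma> \<delta> r (lim_bisim tn \<Sigma> \<delta> \<alpha> i)"
  by (cases r) (simp add: Deg_ge_iff_matching[OF assms] lifted_def)

lemma lim_bisim_antimono:
  "\<beta> \<le> \<alpha> \<Longrightarrow> lim_bisim tn \<Sigma> \<delta> \<alpha> i \<subseteq> lim_bisim tn \<Sigma> \<delta> \<beta> i"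
proof (induction i)
  case (Suc i)
  have "lifted tn \<alpha> (lim_bisim tn \<Sigma> \<delta> \<alpha> i) \<subseteq> lifted tn \<beta> (lim_bisim tn \<Sigma> \<delta> \<beta> i)"
    using sim_mono[OF Suc.IH[OF Suc.prems]] Suc.prems
    unfolding lifted_def by (blast intro: order_trans)
  then show ?case by fastforce
qed simp

section \<open>Stable vectors\<close>

definition stable ::
  "(unit_interval \<Rightarrow> unit_interval \<Rightarrow> unit_interval) \<Rightarrow> 'l set \<Rightarrow> ('v, 'l) transitions
    \<Rightarrow> nat \<Rightarrow> unit_interval \<Rightarrow> 'v relvec \<Rightarrow> bool" where
  "stable tn \<Sigma> \<delta> k \<alpha> T \<longleftrightarrow> (\<forall>i\<in>{1..k}. \<forall>r\<in>T i. \<alpha> \<le> Deg tn \<Sigma> \<delta> r (T (i + 1)))"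

lemma stableD:
  "stable tn \<Sigma> \<delta> k \<alpha> T \<Longrightarrow> 1 \<le> i \<Longrightarrow> i \<le> k \<Longrightarrow> r \<in> T i \<Longrightarrow> \<alpha> \<le> Deg tn \<Sigma> \<delta> r (T (i + 1))"
  by (auto simp: stable_def)

lemma stable_iff_le_min_deg: "stable tn \<Sigma> \<delta> k \<alpha> T \<longleftrightarrow> \<alpha> \<le> min_deg tn \<Sigma> \<delta> k T"
  by (simp add: stable_def min_deg_def le_INF_iff)

text \<open>
  Backwards from the last component, where \<open>\<approx>\<^sub>0\<^sup>\<alpha>\<close> is the full relation: degrees with respect to
  a component do not decrease when that component is replaced by a bisimilarity that contains it.
\<close>

lemma stable_imp_lim_bisim:
  assumes fin: "finite_nfts \<Sigma> \<delta>" and pos: "bot < \<alpha>" and stable: "stable tn \<Sigma> \<delta> k \<alpha> T"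
    and "1 \<le> i" and "i \<le> k + 1"
  shows "T i \<subseteq> lim_bisim tn \<Sigma> \<delta> \<alpha> (k + 1 - i)"
  using assms(5,4)
proof (induction i rule: inc_induct)
  case (step i)
  have k: "k + 1 - i = Suc (k + 1 - Suc i)" using step.hyps by simp
  show ?case
  proof
    fix r assume "r \<in> T i"
    then have "\<alpha> \<le> Deg tn \<Sigma> \<delta> r (T (i + 1))"
      using stableD[OF stable] step by simp
    also have "\<dots> \<le> Deg tn \<Sigma> \<delta> r (lim_bisim tn \<Sigma> \<delta> \<alpha> (k + 1 - Suc i))"
      using step by (intro Deg_mono) simp
    finally show "r \<in> lim_bisim tn \<Sigma> \<delta> \<alpha> (k + 1 - i)"
      unfolding k lim_bisim_Suc_iff_Deg[OF fin pos] .
  qed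
qed simp

lemma reach_SucI:
  "x \<in> reach \<Sigma> \<delta> u n \<Longrightarrow> \<tau> \<in> \<Sigma> \<Longrightarrow> p \<in> post \<delta> x \<tau> \<Longrightarrow> z \<notin> reach \<Sigma> \<delta> u (Suc n) \<Longrightarrow> p z = bot"
  by (auto simp: not_less bot_unique)

text \<open>
  The distributions that enter the degree of a pair of states reachable in \<open>i - 1\<close> steps are
  supported on the states reachable in \<open>i\<close> steps, so restricting the next relation to those states
  leaves all similarities unchanged.
\<close>

lemma stable_reachable_bisim:
  assumes tn: "left_continuous_tnorm tn" and fin: "finite_nfts \<Sigma> \<delta>" and pos: "bot < \<alpha>"
  shows "stable tn \<Sigma> \<delta> k \<alpha> (\<lambda>i. init_vec \<Sigma> \<delta> u v i \<inter> lim_bisim tn \<Sigma> \<delta> \<alpha> (k + 1 - i))"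
  unfolding stable_def
proof (intro ballI)
  fix i r
  assume i: "i \<in> {1..k}"
    and r: "r \<in> init_vec \<Sigma> \<delta> u v i \<inter> lim_bisim tn \<Sigma> \<delta> \<alpha> (k + 1 - i)"
  obtain x y where xy: "r = (x, y)" by fastforce
  obtain n where n: "i = Suc n" using i by (cases i) auto
  have x: "x \<in> reach \<Sigma> \<delta> u n" and y: "y \<in> reach \<Sigma> \<delta> v n"
    using r by (auto simp: init_vec_def xy n)
  have restrict: "sim tn p q (init_vec \<Sigma> \<delta> u v (i + 1) \<inter> R) = sim tn p q R"
    if "\<tau> \<in> \<Sigma>" "p \<in> post \<delta> x \<tau>" "q \<in> post \<delta> y \<tau>" for \<tau> p q R
    unfolding init_vec_def n add_diff_cancel_right'
    by (rule sim_restrict_supports[OF tn])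
      (rule reach_SucI[OF x that(1,2)] reach_SucI[OF y that(1,3)], assumption)+
  have k: "k + 1 - i = Suc (k + 1 - (i + 1))" using i by auto
  have "r \<in> lim_bisim tn \<Sigma> \<delta> \<alpha> (Suc (k + 1 - (i + 1)))" using r unfolding k by blast
  then have "\<alpha> \<le> Deg tn \<Sigma> \<delta> (x, y) (lim_bisim tn \<Sigma> \<delta> \<alpha> (k + 1 - (i + 1)))"
    unfolding lim_bisim_Suc_iff_Deg[OF fin pos] xy .
  then have "\<alpha> \<le> Deg tn \<Sigma> \<delta> (x, y)
      (init_vec \<Sigma> \<delta> u v (i + 1) \<inter> lim_bisim tn \<Sigma> \<delta> \<alpha> (k + 1 - (i + 1)))"
    unfolding Deg_ge_iff_matching[OF fin pos] by (metis restrict)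
  then show "\<alpha> \<le> Deg tn \<Sigma> \<delta> r
      (init_vec \<Sigma> \<delta> u v (i + 1) \<inter> lim_bisim tn \<Sigma> \<delta> \<alpha> (k + 1 - (i + 1)))"
    unfolding xy .
qed

section \<open>One round of the algorithm\<close>

lemma Vec_subset: "Vec tn \<Sigma> \<delta> k \<alpha> C i \<subseteq> C i"
  by (subst Vec.simps) auto

lemma stable_Vec: "stable tn \<Sigma> \<delta> k \<alpha> (Vec tn \<Sigma> \<delta> k \<alpha> C)"
  unfolding stable_def
proof (intro ballI)
  fix i r assume "i \<in> {1..k}" "r \<in> Vec tn \<Sigma> \<delta> k \<alpha> C i"
  then show "\<alpha> \<le> Deg tn \<Sigma> \<delta> r (Vec tn \<Sigma> \<delta> k \<alpha> C (i + 1))"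
    by (subst (asm) Vec.simps) auto
qed

lemma Vec_greatest:
  assumes stable: "stable tn \<Sigma> \<delta> k \<alpha> W"
    and sub: "\<And>i. 1 \<le> i \<Longrightarrow> i \<le> k + 1 \<Longrightarrow> W i \<subseteq> C i"
    and "1 \<le> i" and "i \<le> k + 1"
  shows "W i \<subseteq> Vec tn \<Sigma> \<delta> k \<alpha> C i"
  using assms(4,3)
proof (induction i rule: inc_induct)
  case base
  then show ?case using sub by (subst Vec.simps) simp
next
  case (step i)
  then have "Deg tn \<Sigma> \<delta> r (W (i + 1)) \<le> Deg tn \<Sigma> \<delta> r (Vec tn \<Sigma> \<delta> k \<alpha> C (i + 1))" for r
    by (intro Deg_mono) simp
  then show ?case
    using step sub[of i] stableD[OF stable, of i]
    by (subst Vec.simps) (fastforce intro: order_trans)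
qed

text \<open>
  A pair of a \<open>\<beta>\<close>-stable subvector has degree at least \<open>\<beta>\<close> in the larger vector too, so it is not
  among the pairs of degree at most \<open>\<alpha>\<close>; and being \<open>\<alpha>\<close>-stable, the subvector also survives the
  propagation by \<open>Vec\<close>.
\<close>

lemma stable_subvector_survives:
  assumes stable: "stable tn \<Sigma> \<delta> k \<beta> W" and less: "\<alpha> < \<beta>"
    and sub: "\<And>i. 1 \<le> i \<Longrightarrow> i \<le> k + 1 \<Longrightarrow> W i \<subseteq> T i"
    and "1 \<le> i" and "i \<le> k + 1"
  shows "W i \<subseteq> Vec tn \<Sigma> \<delta> k \<alpha> (delete_vec tn \<Sigma> \<delta> k \<alpha> T) i"
proof (rule Vec_greatest)
  show "stable tn \<Sigma> \<delta> k \<alpha> W"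
    using stable less unfolding stable_iff_le_min_deg by simp
  show "W i \<subseteq> delete_vec tn \<Sigma> \<delta> k \<alpha> T i" if i: "1 \<le> i" "i \<le> k + 1" for i
  proof (cases "i \<le> k")
    case True
    have "\<alpha> < Deg tn \<Sigma> \<delta> r (T (i + 1))" if "r \<in> W i" for r
    proof -
      note less
      also have "\<beta> \<le> Deg tn \<Sigma> \<delta> r (W (i + 1))"
        using stableD[OF stable i(1) True that] .
      also have "\<dots> \<le> Deg tn \<Sigma> \<delta> r (T (i + 1))"
        using True by (intro Deg_mono sub) auto
      finally show ?thesis .
    qed
    then show ?thesis
      using True i sub[OF i] by (force simp: delete_vec_def not_le)
  qed (use sub[OF i] in \<open>simp add: delete_vec_def\<close>)
qed (use assms in auto)

section \<open>The run of the algorithm\<close>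

lemma T_seq_Suc:
  "T_seq tn \<Sigma> \<delta> u v k (Suc j) = Vec tn \<Sigma> \<delta> k (alpha_seq tn \<Sigma> \<delta> u v k (Suc j))
    (delete_vec tn \<Sigma> \<delta> k (alpha_seq tn \<Sigma> \<delta> u v k (Suc j)) (T_seq tn \<Sigma> \<delta> u v k j))"
  by (simp add: alpha_seq_def Let_def)

lemma stable_T_seq: "stable tn \<Sigma> \<delta> k (alpha_seq tn \<Sigma> \<delta> u v k j) (T_seq tn \<Sigma> \<delta> u v k j)"
proof (cases j)
  case 0
  then show ?thesis by (simp add: stable_iff_le_min_deg alpha_seq_def)
next
  case (Suc j')
  then show ?thesis by (simp only: T_seq_Suc stable_Vec)
qed

lemma alpha_seq_Suc_ge: "alpha_seq tn \<Sigma> \<delta> u v k j \<le> alpha_seq tn \<Sigma> \<delta> u v k (Suc j)"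
  using stable_T_seq[of tn \<Sigma> \<delta> k u v j]
  by (simp add: stable_iff_le_min_deg alpha_seq_def)

lemma T_seq_0: "T_seq tn \<Sigma> \<delta> u v k 0 = init_vec \<Sigma> \<delta> u v"
proof
  show "T_seq tn \<Sigma> \<delta> u v k 0 i = init_vec \<Sigma> \<delta> u v i" for i
    unfolding T_seq.simps by (subst Vec.simps) simp
qed

lemma T_seq_Suc_subset_delete:
  "T_seq tn \<Sigma> \<delta> u v k (Suc j) i
    \<subseteq> delete_vec tn \<Sigma> \<delta> k (min_deg tn \<Sigma> \<delta> k (T_seq tn \<Sigma> \<delta> u v k j)) (T_seq tn \<Sigma> \<delta> u v k j) i"
  unfolding T_seq.simps Let_def by (rule Vec_subset)

lemma T_seq_Suc_subset: "T_seq tn \<Sigma> \<delta> u v k (Suc j) i \<subseteq> T_seq tn \<Sigma> \<delta> u v k j i"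
  using T_seq_Suc_subset_delete[of tn \<Sigma> \<delta> u v k j i]
  by (auto simp: delete_vec_def simp del: T_seq.simps split: if_splits)

lemma T_seq_subset_init: "T_seq tn \<Sigma> \<delta> u v k j i \<subseteq> init_vec \<Sigma> \<delta> u v i"
proof (induction j)
  case 0
  then show ?case by (simp only: T_seq_0 order_refl)
next
  case (Suc j)
  then show ?case using T_seq_Suc_subset by (rule order_trans[rotated])
qed

lemma stable_subset_T_seq:
  assumes stable: "stable tn \<Sigma> \<delta> k \<beta> W"
    and sub: "\<And>i. 1 \<le> i \<Longrightarrow> i \<le> k + 1 \<Longrightarrow> W i \<subseteq> init_vec \<Sigma> \<delta> u v i"
    and "alpha_seq tn \<Sigma> \<delta> u v k j < \<beta>" and "1 \<le> i" and "i \<le> k + 1"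
  shows "W i \<subseteq> T_seq tn \<Sigma> \<delta> u v k j i"
  using assms(3-5)
proof (induction j arbitrary: i)
  case 0
  then show ?case using sub by (simp only: T_seq_0)
next
  case (Suc j)
  have "alpha_seq tn \<Sigma> \<delta> u v k j < \<beta>"
    using alpha_seq_Suc_ge Suc.prems(1) by (rule le_less_trans)
  then show ?case
    unfolding T_seq_Suc using Suc.prems
    by (intro stable_subvector_survives[OF stable] Suc.IH) auto
qed

section \<open>Termination\<close>

text \<open>
  As the first component is nonempty, the minimal degree is a minimum over a finite nonempty set of
  pairs, hence attained; the pair that attains it is deleted.
\<close>

lemma T_seq_decreases:
  fixes \<delta> :: "('v::finite, 'l) transitions"
  assumes "k \<ge> 1" and "T_seq tn \<Sigma> \<delta> u v k j 1 \<noteq> {}"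
  shows "(\<Sum>i=1..k. card (T_seq tn \<Sigma> \<delta> u v k (Suc j) i)) < (\<Sum>i=1..k. card (T_seq tn \<Sigma> \<delta> u v k j i))"
proof -
  let ?T = "T_seq tn \<Sigma> \<delta> u v k j"
  let ?D = "(\<lambda>(i, r). Deg tn \<Sigma> \<delta> r (?T (i + 1))) ` (SIGMA i:{1..k}. ?T i)"
  have "min_deg tn \<Sigma> \<delta> k ?T = Inf ?D"
    unfolding min_deg_def
    by (rule antisym) (auto intro!: INF_greatest Inf_greatest intro: INF_lower2 Inf_lower)
  also have "\<dots> = Min ?D"
    using assms by (intro Min_Inf[symmetric]) force+
  also have "Min ?D \<in> ?D"
    using assms by (intro Min_in) force+
  finally obtain i r where i: "1 \<le> i" "i \<le> k" and r: "r \<in> ?T i"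
    and "Deg tn \<Sigma> \<delta> r (?T (i + 1)) = min_deg tn \<Sigma> \<delta> k ?T"
    by auto
  then have "r \<notin> T_seq tn \<Sigma> \<delta> u v k (Suc j) i"
    using T_seq_Suc_subset_delete[of tn \<Sigma> \<delta> u v k j i] by (auto simp: delete_vec_def)
  then have "T_seq tn \<Sigma> \<delta> u v k (Suc j) i \<subset> ?T i"
    using r T_seq_Suc_subset[of tn \<Sigma> \<delta> u v k j i] by blast
  then have "card (T_seq tn \<Sigma> \<delta> u v k (Suc j) i) < card (?T i)"
    by (intro psubset_card_mono) auto
  then show ?thesis
    using i by (intro sum_strict_mono_ex1) (auto intro!: card_mono T_seq_Suc_subset simp del: T_seq.simps)
qed

lemma terminates_if_pos:
  fixes \<delta> :: "('v::finite, 'l) transitions"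
  assumes "k \<ge> 1"
  shows "terminates tn \<Sigma> \<delta> u v k"
proof (rule ccontr)
  define size where "size j = (\<Sum>i=1..k. card (T_seq tn \<Sigma> \<delta> u v k j i))" for j
  assume "\<not> terminates tn \<Sigma> \<delta> u v k"
  then have "size (Suc j) < size j" for j
    unfolding size_def terminates_def using T_seq_decreases[OF assms] by blast
  then show False
    using wf_no_infinite_down_chainE[OF wf_less_than, of size] by auto
qed

section \<open>Correctness of the returned degree\<close>

lemma init_vec_1: "init_vec \<Sigma> \<delta> u v 1 = {(u, v)}"
  by (simp add: init_vec_def)

lemma bisim_imp_le_alpha_seq:
  assumes "left_continuous_tnorm tn" and "finite_nfts \<Sigma> \<delta>"
    and empty: "T_seq tn \<Sigma> \<delta> u v k j 1 = {}" and bisim: "(u, v) \<in> lim_bisim tn \<Sigma> \<delta> \<alpha> k"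
  shows "\<alpha> \<le> alpha_seq tn \<Sigma> \<delta> u v k j"
proof (rule ccontr)
  assume "\<not> ?thesis"
  then have less: "alpha_seq tn \<Sigma> \<delta> u v k j < \<alpha>" by simp
  then have "bot < \<alpha>" by (rule le_less_trans[OF bot_least])
  then have "init_vec \<Sigma> \<delta> u v 1 \<inter> lim_bisim tn \<Sigma> \<delta> \<alpha> (k + 1 - 1) \<subseteq> T_seq tn \<Sigma> \<delta> u v k j 1"
    using less by (intro stable_subset_T_seq[OF stable_reachable_bisim[OF assms(1,2)]]) auto
  then show False using empty bisim unfolding init_vec_1 by simp
qed

text \<open>
  Bisimilarity need only be shown for \<open>\<beta> > 0\<close>: if \<open>\<beta> = 0\<close>, then either no threshold relates
  the states, and their degree is 0 by convention, or some threshold does, and then so does 0.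
\<close>

lemma is_degreeI:
  assumes bisim: "bot < \<beta> \<Longrightarrow> (u, v) \<in> lim_bisim tn \<Sigma> \<delta> \<beta> k"
    and greatest: "\<And>\<alpha>. (u, v) \<in> lim_bisim tn \<Sigma> \<delta> \<alpha> k \<Longrightarrow> \<alpha> \<le> \<beta>"
  shows "is_degree tn \<Sigma> \<delta> u v k \<beta>"
proof (cases "bot < \<beta>")
  case True
  then show ?thesis using bisim greatest unfolding is_degree_def by auto
next
  case False
  then have "\<beta> = bot" by (simp add: not_less bot_unique)
  then show ?thesis
    using greatest subsetD[OF lim_bisim_antimono[OF bot_least]] unfolding is_degree_def by auto
qed

text \<open>
  For \<open>k = 0\<close> the loop does not end, and from the first round on its threshold is 1, which is the
  degree since \<open>\<approx>\<^sub>0\<^sup>1\<close> is the full relation.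
\<close>

lemma BIS_0: "BIS tn \<Sigma> \<delta> u v 0 = top"
proof -
  have "T_seq tn \<Sigma> \<delta> u v 0 j 1 = {(u, v)}" for j
    by (induction j) (simp_all add: Vec.simps Let_def delete_vec_def init_vec_def)
  then have "BIS tn \<Sigma> \<delta> u v 0 = (SUP j. alpha_seq tn \<Sigma> \<delta> u v 0 j)"
    by (simp add: BIS_def terminates_def)
  moreover have "alpha_seq tn \<Sigma> \<delta> u v 0 1 = top"
    by (simp add: alpha_seq_def min_deg_def)
  ultimately show ?thesis
    by (metis SUP_upper UNIV_I top_le)
qed

theorem theorem5p2:
  fixes tn :: "unit_interval \<Rightarrow> unit_interval \<Rightarrow> unit_interval"
    and \<Sigma> :: "'l set"
    and \<delta> :: "('v::finite, 'l) transitions"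
    and u v :: 'v
    and k :: nat
  assumes "left_continuous_tnorm tn"
    and "finite_nfts \<Sigma> \<delta>"
  shows "(k \<ge> 1 \<longrightarrow> terminates tn \<Sigma> \<delta> u v k) \<and>
    is_degree tn \<Sigma> \<delta> u v k (BIS tn \<Sigma> \<delta> u v k)"
proof (intro conjI impI)
  show "terminates tn \<Sigma> \<delta> u v k" if "k \<ge> 1"
    using that by (rule terminates_if_pos)
  show "is_degree tn \<Sigma> \<delta> u v k (BIS tn \<Sigma> \<delta> u v k)"
  proof (cases "k = 0")
    case True
    then show ?thesis by (auto intro: is_degreeI simp: BIS_0)
  next
    case False
    then have stops: "\<exists>j. T_seq tn \<Sigma> \<delta> u v k j 1 = {}"
      using terminates_if_pos[of k tn \<Sigma> \<delta> u v] by (simp add: terminates_def)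
    define n where "n = (LEAST j. T_seq tn \<Sigma> \<delta> u v k j 1 = {})"
    have empty: "T_seq tn \<Sigma> \<delta> u v k n 1 = {}"
      unfolding n_def using stops by (rule LeastI_ex)
    have "n \<noteq> 0"
      using empty unfolding n_def[symmetric] by (metis T_seq_0 init_vec_1 insert_not_empty)
    then obtain m where m: "n = Suc m" using not0_implies_Suc by blast
    have "T_seq tn \<Sigma> \<delta> u v k m 1 \<noteq> {}"
      using not_less_Least[of m "\<lambda>j. T_seq tn \<Sigma> \<delta> u v k j 1 = {}"] unfolding n_def[symmetric] m by simp
    then have uv: "(u, v) \<in> T_seq tn \<Sigma> \<delta> u v k m 1"
      using T_seq_subset_init[of tn \<Sigma> \<delta> u v k m 1] unfolding init_vec_1 by blast
    \<comment> \<open>The returned threshold is the minimal degree of the preceding vector, so that vector is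
      stable for it and not only for its own threshold.\<close>
    have stable: "stable tn \<Sigma> \<delta> k (alpha_seq tn \<Sigma> \<delta> u v k n) (T_seq tn \<Sigma> \<delta> u v k m)"
      by (simp add: stable_iff_le_min_deg alpha_seq_def m)
    have "is_degree tn \<Sigma> \<delta> u v k (alpha_seq tn \<Sigma> \<delta> u v k n)"
    proof (rule is_degreeI)
      assume "bot < alpha_seq tn \<Sigma> \<delta> u v k n"
      from stable_imp_lim_bisim[OF assms(2) this stable, of 1]
      show "(u, v) \<in> lim_bisim tn \<Sigma> \<delta> (alpha_seq tn \<Sigma> \<delta> u v k n) k"
        using uv by auto
    qed (rule bisim_imp_le_alpha_seq[OF assms empty])
    then show ?thesis
      using stops by (simp add: BIS_def terminates_def n_def)
  qed
qed

end
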